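(* Let $\mathcal{A}$ be a Banach algebra and let $\varphi\in\Delta(\mathcal{A})$. If $\mathcal{A}^{**}$ has an ultra central approximate identity, then $\mathcal{A}$ is $\varphi$-inner amenable.
   Context: $\Delta(\mathcal{A})$ is the set of non-zero multiplicative linear functionals on $\mathcal{A}$. The second dual of a Banach algebra is a Banach algebra under the first Arens product. A Banach algebra $\mathcal{B}$ has an ultra central approximate identity if there is a (not necessarily bounded) net $(e_\alpha)$ in $\mathcal{B}^{**}$ such that $be_\alpha=e_\alpha b$ for all $\alpha$ and $e_\alpha b\to b$ in norm, for every $b\in\mathcal{B}$. (Here this is applied with $\mathcal{B}=\mathcal{A}^{**}$.) For $\varphi\in\Delta(\mathcal{A})$, put $\mathcal{A}_\varphi=\{a\in\mathcal{A}:\varphi(a)=1\}$. $\mathcal{A}$ is $\varphi$-inner amenable if there is a bounded linear functional $m$ on $\mathcal{A}^*$ with $m(\varphi)=1$ and $m(f\cdot a)=m(a\cdot f)$ for every $f\in\mathcal{A}^*$ and $a\in\mathcal{A}_\varphi$, where $\mathcal{A}^*$ carries the dual $\mathcal{A}$-bimodule actions. *)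

theory Defs
  imports "HOL-Analysis.Analysis"
begin

section \<open>Complex Banach algebras\<close>

class complex_normed_vector = real_normed_vector +
  fixes scaleC :: "complex \<Rightarrow> 'a \<Rightarrow> 'a"  (infixr "*\<^sub>C" 75)
  assumes scaleC_add_right: "c *\<^sub>C (x + y) = c *\<^sub>C x + c *\<^sub>C y"
    and scaleC_add_left: "(c + d) *\<^sub>C x = c *\<^sub>C x + d *\<^sub>C x"
    and scaleC_scaleC: "c *\<^sub>C (d *\<^sub>C x) = (c * d) *\<^sub>C x"
    and scaleC_of_real: "complex_of_real r *\<^sub>C x = r *\<^sub>R x"
    and norm_scaleC: "norm (c *\<^sub>C x) = cmod c * norm x"

text \<open>As in \<^class>\<open>real_normed_algebra\<close>, no unit is assumed.\<close>

class complex_banach_algebra = complex_normed_vector + real_normed_algebra + banach +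
  assumes mult_scaleC_left: "(c *\<^sub>C x) * y = c *\<^sub>C (x * y)"
    and mult_scaleC_right: "x * (c *\<^sub>C y) = c *\<^sub>C (x * y)"

section \<open>The dual space\<close>

definition bounded_clinear_functional :: "('a::complex_normed_vector \<Rightarrow> complex) \<Rightarrow> bool" where
  "bounded_clinear_functional f \<longleftrightarrow> bounded_linear f \<and> (\<forall>c x. f (c *\<^sub>C x) = c * f x)"

typedef (overloaded) 'a dual = "{f :: 'a::complex_normed_vector \<Rightarrow> complex. bounded_clinear_functional f}"
  morphisms dual_apply Dual
  by (rule exI[of _ "\<lambda>_. 0"]) (simp add: bounded_clinear_functional_def)

setup_lifting type_definition_dual

lemma dual_eqI: "(\<And>x. dual_apply f x = dual_apply g x) \<Longrightarrow> f = g"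
  by transfer auto

lemma bounded_clinear_dual_apply: "bounded_clinear_functional (dual_apply f)"
  by transfer auto

lemma bounded_linear_dual_apply: "bounded_linear (dual_apply f)"
  using bounded_clinear_dual_apply by (auto simp: bounded_clinear_functional_def)

lemma dual_apply_scaleC_right: "dual_apply f (c *\<^sub>C x) = c * dual_apply f x"
  using bounded_clinear_dual_apply[of f] by (auto simp: bounded_clinear_functional_def)

lemmas dual_apply_add_right = bounded_linear.linear[OF bounded_linear_dual_apply, THEN linear_add]

lemma dual_apply_Dual: "bounded_clinear_functional f \<Longrightarrow> dual_apply (Dual f) = f"
  by (simp add: Dual_inverse)

lemma bounded_clinear_functionalI:
  assumes "\<And>x y. f (x + y) = f x + f y" "\<And>c x. f (c *\<^sub>C x) = c * f x"
    and "\<And>x. cmod (f x) \<le> K * norm x"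
  shows "bounded_clinear_functional f"
  unfolding bounded_clinear_functional_def
proof (intro conjI bounded_linear_intro[where K = K] allI)
  show "f (r *\<^sub>R x) = r *\<^sub>R f x" for r x
    using assms(2)[of "complex_of_real r" x] by (simp add: scaleC_of_real scaleR_conv_of_real)
qed (use assms in \<open>auto simp: mult.commute\<close>)

instantiation dual :: (complex_normed_vector) real_normed_vector
begin

lift_definition zero_dual :: "'a dual" is "\<lambda>_. 0"
  by (simp add: bounded_clinear_functional_def)

lift_definition plus_dual :: "'a dual \<Rightarrow> 'a dual \<Rightarrow> 'a dual" is "\<lambda>f g x. f x + g x"
  by (auto simp: bounded_clinear_functional_def bounded_linear_add algebra_simps)

lift_definition minus_dual :: "'a dual \<Rightarrow> 'a dual \<Rightarrow> 'a dual" is "\<lambda>f g x. f x - g x"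
  by (auto simp: bounded_clinear_functional_def bounded_linear_sub algebra_simps)

lift_definition uminus_dual :: "'a dual \<Rightarrow> 'a dual" is "\<lambda>f x. - f x"
  by (auto simp: bounded_clinear_functional_def bounded_linear_minus)

lift_definition scaleR_dual :: "real \<Rightarrow> 'a dual \<Rightarrow> 'a dual" is "\<lambda>r f x. r *\<^sub>R f x"
  by (auto simp: bounded_clinear_functional_def bounded_linear_const_scaleR)

lift_definition norm_dual :: "'a dual \<Rightarrow> real" is onorm .

definition dist_dual :: "'a dual \<Rightarrow> 'a dual \<Rightarrow> real" where
  "dist_dual f g = norm (f - g)"

definition sgn_dual :: "'a dual \<Rightarrow> 'a dual" where
  "sgn_dual f = inverse (norm f) *\<^sub>R f"

definition [code del]:
  "(uniformity :: ('a dual \<times> 'a dual) filter) = (INF e\<in>{0<..}. principal {(x, y). dist x y < e})"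

definition open_dual :: "'a dual set \<Rightarrow> bool" where
  [code del]: "open_dual S = (\<forall>x\<in>S. \<forall>\<^sub>F (x', y) in uniformity. x' = x \<longrightarrow> y \<in> S)"

instance
proof
  fix f g h :: "'a dual" and r s :: real
  show "dist f g = norm (f - g)" by (rule dist_dual_def)
  show "sgn f = inverse (norm f) *\<^sub>R f" by (rule sgn_dual_def)
  show "(uniformity :: ('a dual \<times> 'a dual) filter) = (INF e\<in>{0<..}. principal {(x, y). dist x y < e})"
    by (rule uniformity_dual_def)
  show "open S = (\<forall>x\<in>S. \<forall>\<^sub>F (x', y) in uniformity. x' = x \<longrightarrow> y \<in> S)" for S :: "'a dual set"
    by (rule open_dual_def)
  show "f + g + h = f + (g + h)" "f + g = g + f" "0 + f = f" "- f + f = 0" "f - g = f + - g"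
    by (transfer; simp add: add_ac)+
  show "r *\<^sub>R (f + g) = r *\<^sub>R f + r *\<^sub>R g" "(r + s) *\<^sub>R f = r *\<^sub>R f + s *\<^sub>R f"
    "r *\<^sub>R s *\<^sub>R f = (r * s) *\<^sub>R f" "1 *\<^sub>R f = f"
    by (transfer; simp add: scaleR_add_right scaleR_add_left)+
  show "(norm f = 0) = (f = 0)"
    by transfer (auto simp: bounded_clinear_functional_def onorm_eq_0)
  show "norm (f + g) \<le> norm f + norm g"
    by transfer (auto simp: bounded_clinear_functional_def intro: onorm_triangle)
  show "norm (r *\<^sub>R f) = \<bar>r\<bar> * norm f"
    by transfer (auto simp: bounded_clinear_functional_def onorm_scaleR)
qed

end

lemma norm_dual_le: "cmod (dual_apply f x) \<le> norm f * norm x"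
  using onorm[OF bounded_linear_dual_apply[of f], of x] by (simp add: norm_dual.rep_eq)

lemma norm_dual_bound:
  "0 \<le> K \<Longrightarrow> (\<And>x. cmod (dual_apply f x) \<le> K * norm x) \<Longrightarrow> norm f \<le> K"
  by (simp add: norm_dual.rep_eq onorm_bound)

instantiation dual :: (complex_normed_vector) complex_normed_vector
begin

lift_definition scaleC_dual :: "complex \<Rightarrow> 'a dual \<Rightarrow> 'a dual" is "\<lambda>c f x. c * f x"
  by (auto simp: bounded_clinear_functional_def bounded_linear_const_mult)

instance
proof
  fix f g :: "'a dual" and c d :: complex and r :: real
  show "c *\<^sub>C (f + g) = c *\<^sub>C f + c *\<^sub>C g" "(c + d) *\<^sub>C f = c *\<^sub>C f + d *\<^sub>C f"
    "c *\<^sub>C d *\<^sub>C f = (c * d) *\<^sub>C f" "complex_of_real r *\<^sub>C f = r *\<^sub>R f"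
    by (transfer; auto simp: algebra_simps scaleR_conv_of_real)+
  have le: "norm (c *\<^sub>C f) \<le> cmod c * norm f" for c and f :: "'a dual"
  proof (rule norm_dual_bound)
    fix x
    show "cmod (dual_apply (c *\<^sub>C f) x) \<le> cmod c * norm f * norm x"
      using mult_left_mono[OF norm_dual_le[of f x], of "cmod c"]
      by (simp add: scaleC_dual.rep_eq norm_mult mult.assoc)
  qed simp
  show "norm (c *\<^sub>C f) = cmod c * norm f"
  proof (cases "c = 0")
    case True
    then show ?thesis using le[of c f] by simp
  next
    case False
    have "inverse c *\<^sub>C c *\<^sub>C f = f"
      using False by transfer (auto simp: fun_eq_iff)
    then have "norm f \<le> inverse (cmod c) * norm (c *\<^sub>C f)"
      using le[of "inverse c" "c *\<^sub>C f"] by (simp add: norm_inverse)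
    then show ?thesis
      using le[of c f] False by (simp add: field_simps)
  qed
qed

end

instance dual :: (complex_normed_vector) banach
proof
  fix X :: "nat \<Rightarrow> 'a dual"
  assume X: "Cauchy X"
  have bl: "blinfun_apply (Blinfun (dual_apply f)) = dual_apply f" for f :: "'a dual"
    by (simp add: bounded_linear_Blinfun_apply bounded_linear_dual_apply)
  have nrm: "norm (Blinfun (dual_apply f) - Blinfun (dual_apply g)) = norm (f - g)"
    for f g :: "'a dual"
  proof -
    have "(\<lambda>x. blinfun_apply (Blinfun (dual_apply f) - Blinfun (dual_apply g)) x) = dual_apply (f - g)"
      by (simp add: fun_eq_iff blinfun.diff_left bl minus_dual.rep_eq)
    then show ?thesis by (simp add: norm_blinfun.rep_eq norm_dual.rep_eq)
  qed
  have "Cauchy (\<lambda>n. Blinfun (dual_apply (X n)))"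
    using X by (simp add: Cauchy_def dist_norm nrm)
  then obtain L where L: "(\<lambda>n. Blinfun (dual_apply (X n))) \<longlonglongrightarrow> L"
    using Cauchy_convergent_iff convergent_def by blast
  have pt: "(\<lambda>n. dual_apply (X n) x) \<longlonglongrightarrow> blinfun_apply L x" for x
    using blinfun.tendsto[OF L tendsto_const[of x]] by (simp add: bl)
  have hom: "blinfun_apply L (c *\<^sub>C x) = c * blinfun_apply L x" for c x
  proof (rule LIMSEQ_unique)
    show "(\<lambda>n. dual_apply (X n) (c *\<^sub>C x)) \<longlonglongrightarrow> blinfun_apply L (c *\<^sub>C x)" by (rule pt)
    show "(\<lambda>n. dual_apply (X n) (c *\<^sub>C x)) \<longlonglongrightarrow> c * blinfun_apply L x"
      unfolding dual_apply_scaleC_right by (intro tendsto_intros pt)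
  qed
  have apD: "dual_apply (Dual (blinfun_apply L)) = blinfun_apply L"
    by (rule dual_apply_Dual)
      (simp add: bounded_clinear_functional_def hom blinfun.bounded_linear_right)
  have "X \<longlonglongrightarrow> Dual (blinfun_apply L)"
  proof -
    have "(\<lambda>n. norm (Blinfun (dual_apply (X n)) - L)) \<longlonglongrightarrow> 0"
      using L by (simp add: LIM_zero tendsto_norm_zero)
    moreover have "norm (Blinfun (dual_apply (X n)) - L) = norm (X n - Dual (blinfun_apply L))" for n
      using nrm[of "X n" "Dual (blinfun_apply L)"] by (simp add: apD blinfun_apply_inverse)
    ultimately show ?thesis
      by (simp add: LIM_zero_iff tendsto_norm_zero_iff)
  qed
  then show "convergent X" by (rule convergentI)
qed

definition canonical :: "'a::complex_normed_vector \<Rightarrow> 'a dual dual" where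
  "canonical x = Dual (\<lambda>f. dual_apply f x)"

lemma dual_apply_canonical: "dual_apply (canonical x) f = dual_apply f x"
  unfolding canonical_def
  by (subst dual_apply_Dual)
    (auto intro!: bounded_clinear_functionalI[where K = "norm x"]
      simp: plus_dual.rep_eq scaleC_dual.rep_eq norm_dual_le mult.commute[of "norm x"])

section \<open>Dual bimodule actions\<close>

text \<open>For a Banach algebra \<open>A\<close>, these are \<open>f \<cdot> a\<close> and \<open>a \<cdot> f\<close> for \<open>f\<close> in the dual \<open>A*\<close>,
  and \<open>m \<cdot> a\<close> and \<open>a \<cdot> m\<close> for \<open>m\<close> in the second dual \<open>A**\<close>.\<close>

definition dual_ract :: "'a::complex_banach_algebra dual \<Rightarrow> 'a \<Rightarrow> 'a dual" where
  "dual_ract f a = Dual (\<lambda>x. dual_apply f (a * x))"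

definition dual_lact :: "'a::complex_banach_algebra \<Rightarrow> 'a dual \<Rightarrow> 'a dual" where
  "dual_lact a f = Dual (\<lambda>x. dual_apply f (x * a))"

definition bidual_ract :: "'a::complex_banach_algebra dual dual \<Rightarrow> 'a \<Rightarrow> 'a dual dual" where
  "bidual_ract m a = Dual (\<lambda>f. dual_apply m (dual_lact a f))"

definition bidual_lact :: "'a::complex_banach_algebra \<Rightarrow> 'a dual dual \<Rightarrow> 'a dual dual" where
  "bidual_lact a m = Dual (\<lambda>f. dual_apply m (dual_ract f a))"

lemma dual_apply_le: "norm x \<le> K \<Longrightarrow> cmod (dual_apply f x) \<le> norm f * K"
  by (rule order_trans[OF norm_dual_le]) (simp add: mult_left_mono)

lemma dual_apply_ract: "dual_apply (dual_ract f a) x = dual_apply f (a * x)"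
  unfolding dual_ract_def
  by (subst dual_apply_Dual)
    (auto intro!: bounded_clinear_functionalI[where K = "norm f * norm a"]
      dual_apply_le norm_mult_ineq
      simp: distrib_left dual_apply_add_right mult_scaleC_right dual_apply_scaleC_right mult.assoc)

lemma dual_apply_lact: "dual_apply (dual_lact a f) x = dual_apply f (x * a)"
  unfolding dual_lact_def
  by (subst dual_apply_Dual)
    (auto intro!: bounded_clinear_functionalI[where K = "norm f * norm a"]
      dual_apply_le order_trans[OF norm_mult_ineq]
      simp: distrib_right dual_apply_add_right mult_scaleC_left dual_apply_scaleC_right
        mult.assoc mult.commute[of "norm a"])

lemma norm_dual_ract_le: "norm (dual_ract f a) \<le> norm f * norm a"
  by (rule norm_dual_bound)
    (auto simp: dual_apply_ract mult.assoc intro!: dual_apply_le norm_mult_ineq)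

lemma norm_dual_lact_le: "norm (dual_lact a f) \<le> norm a * norm f"
  by (rule norm_dual_bound)
    (auto simp: dual_apply_lact mult.assoc mult.left_commute[of "norm a"] mult.commute[of "norm a"]
      intro!: dual_apply_le norm_mult_ineq)

lemma dual_apply_bidual_ract: "dual_apply (bidual_ract m a) f = dual_apply m (dual_lact a f)"
proof -
  have "dual_lact a (f + g) = dual_lact a f + dual_lact a g"
    "dual_lact a (c *\<^sub>C f) = c *\<^sub>C dual_lact a f" for f g c
    by (rule dual_eqI; simp add: dual_apply_lact plus_dual.rep_eq scaleC_dual.rep_eq)+
  then show ?thesis unfolding bidual_ract_def
    by (subst dual_apply_Dual)
      (auto intro!: bounded_clinear_functionalI[where K = "norm m * norm a"]
        dual_apply_le norm_dual_lact_le simp: dual_apply_add_right dual_apply_scaleC_right mult.assoc)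
qed

lemma dual_apply_bidual_lact: "dual_apply (bidual_lact a m) f = dual_apply m (dual_ract f a)"
proof -
  have "dual_ract (f + g) a = dual_ract f a + dual_ract g a"
    "dual_ract (c *\<^sub>C f) a = c *\<^sub>C dual_ract f a" for f g c
    by (rule dual_eqI; simp add: dual_apply_ract plus_dual.rep_eq scaleC_dual.rep_eq)+
  moreover have "norm (dual_ract f a) \<le> norm a * norm f" for f
    using norm_dual_ract_le[of f a] by (simp add: mult.commute)
  ultimately show ?thesis unfolding bidual_lact_def
    by (subst dual_apply_Dual)
      (auto intro!: bounded_clinear_functionalI[where K = "norm m * norm a"]
        dual_apply_le simp: dual_apply_add_right dual_apply_scaleC_right mult.assoc)
qed

section \<open>The second dual as a Banach algebra\<close>

text \<open>The first Arens product is \<open>\<langle>m \<box> n, f\<rangle> = \<langle>m, n \<cdot> f\<rangle>\<close>, where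
  \<open>\<langle>n \<cdot> f, a\<rangle> = \<langle>n, f \<cdot> a\<rangle>\<close>.\<close>

definition arens_act :: "'a::complex_banach_algebra dual dual \<Rightarrow> 'a dual \<Rightarrow> 'a dual" where
  "arens_act n f = Dual (\<lambda>a. dual_apply n (dual_ract f a))"

definition arens_prod ::
    "'a::complex_banach_algebra dual dual \<Rightarrow> 'a dual dual \<Rightarrow> 'a dual dual" where
  "arens_prod m n = Dual (\<lambda>f. dual_apply m (arens_act n f))"

lemma dual_apply_arens_act: "dual_apply (arens_act n f) a = dual_apply n (dual_ract f a)"
proof -
  have "dual_ract f (a + b) = dual_ract f a + dual_ract f b"
    "dual_ract f (c *\<^sub>C a) = c *\<^sub>C dual_ract f a" for a b c
    by (rule dual_eqI; simp add: dual_apply_ract plus_dual.rep_eq scaleC_dual.rep_eq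
        distrib_right dual_apply_add_right mult_scaleC_left dual_apply_scaleC_right)+
  then show ?thesis unfolding arens_act_def
    by (subst dual_apply_Dual)
      (auto intro!: bounded_clinear_functionalI[where K = "norm n * norm f"]
        dual_apply_le norm_dual_ract_le simp: dual_apply_add_right dual_apply_scaleC_right mult.assoc)
qed

lemma norm_arens_act_le: "norm (arens_act n f) \<le> norm n * norm f"
  by (rule norm_dual_bound)
    (auto simp: dual_apply_arens_act mult.assoc intro!: dual_apply_le norm_dual_ract_le)

lemma dual_apply_arens_prod: "dual_apply (arens_prod m n) f = dual_apply m (arens_act n f)"
proof -
  have "dual_ract (f + g) a = dual_ract f a + dual_ract g a"
    "dual_ract (c *\<^sub>C f) a = c *\<^sub>C dual_ract f a" for f g :: "'a dual" and c a
    by (rule dual_eqI; simp add: dual_apply_ract plus_dual.rep_eq scaleC_dual.rep_eq)+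
  then have "arens_act n (f + g) = arens_act n f + arens_act n g"
    "arens_act n (c *\<^sub>C f) = c *\<^sub>C arens_act n f" for f g c
    by (intro dual_eqI; simp add: dual_apply_arens_act plus_dual.rep_eq scaleC_dual.rep_eq
        dual_apply_add_right dual_apply_scaleC_right)+
  then show ?thesis unfolding arens_prod_def
    by (subst dual_apply_Dual)
      (auto intro!: bounded_clinear_functionalI[where K = "norm m * norm n"]
        dual_apply_le norm_arens_act_le simp: dual_apply_add_right dual_apply_scaleC_right mult.assoc)
qed

lemma norm_arens_prod_le: "norm (arens_prod m n) \<le> norm m * norm n"
  by (rule norm_dual_bound)
    (auto simp: dual_apply_arens_prod mult.assoc intro!: dual_apply_le norm_arens_act_le)

lemma arens_prod_assoc: "arens_prod (arens_prod m n) p = arens_prod m (arens_prod n p)"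
proof -
  have 1: "dual_ract (dual_ract f a) b = dual_ract f (a * b)" for f :: "'a dual" and a b
    by (rule dual_eqI) (simp add: dual_apply_ract mult.assoc)
  have 2: "dual_ract (arens_act p f) a = arens_act p (dual_ract f a)" for f a
    by (rule dual_eqI) (simp add: dual_apply_ract dual_apply_arens_act 1)
  have "arens_act n (arens_act p f) = arens_act (arens_prod n p) f" for f
    by (rule dual_eqI) (simp add: dual_apply_arens_act dual_apply_arens_prod 2)
  then show ?thesis
    by (intro dual_eqI) (simp add: dual_apply_arens_prod)
qed

text \<open>A copy of \<^typ>\<open>'a dual dual\<close> that can be made an instance of \<^class>\<open>complex_banach_algebra\<close>.\<close>

typedef (overloaded) 'a bidual = "UNIV :: 'a::complex_banach_algebra dual dual set"
  morphisms of_bidual Bidual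
  by simp

setup_lifting type_definition_bidual

instantiation bidual :: (complex_banach_algebra) real_normed_vector
begin

lift_definition zero_bidual :: "'a bidual" is 0 .
lift_definition plus_bidual :: "'a bidual \<Rightarrow> 'a bidual \<Rightarrow> 'a bidual" is "(+)" .
lift_definition minus_bidual :: "'a bidual \<Rightarrow> 'a bidual \<Rightarrow> 'a bidual" is "(-)" .
lift_definition uminus_bidual :: "'a bidual \<Rightarrow> 'a bidual" is uminus .
lift_definition scaleR_bidual :: "real \<Rightarrow> 'a bidual \<Rightarrow> 'a bidual" is scaleR .
lift_definition norm_bidual :: "'a bidual \<Rightarrow> real" is norm .

definition dist_bidual :: "'a bidual \<Rightarrow> 'a bidual \<Rightarrow> real" where
  "dist_bidual m n = norm (m - n)"

definition sgn_bidual :: "'a bidual \<Rightarrow> 'a bidual" where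
  "sgn_bidual m = inverse (norm m) *\<^sub>R m"

definition [code del]:
  "(uniformity :: ('a bidual \<times> 'a bidual) filter) = (INF e\<in>{0<..}. principal {(x, y). dist x y < e})"

definition open_bidual :: "'a bidual set \<Rightarrow> bool" where
  [code del]: "open_bidual S = (\<forall>x\<in>S. \<forall>\<^sub>F (x', y) in uniformity. x' = x \<longrightarrow> y \<in> S)"

instance
proof
  fix m n p :: "'a bidual" and r s :: real
  show "dist m n = norm (m - n)" by (rule dist_bidual_def)
  show "sgn m = inverse (norm m) *\<^sub>R m" by (rule sgn_bidual_def)
  show "(uniformity :: ('a bidual \<times> 'a bidual) filter) = (INF e\<in>{0<..}. principal {(x, y). dist x y < e})"
    by (rule uniformity_bidual_def)
  show "open S = (\<forall>x\<in>S. \<forall>\<^sub>F (x', y) in uniformity. x' = x \<longrightarrow> y \<in> S)" for S :: "'a bidual set"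
    by (rule open_bidual_def)
  show "m + n + p = m + (n + p)" "m + n = n + m" "0 + m = m" "- m + m = 0" "m - n = m + - n"
    by (transfer; simp)+
  show "r *\<^sub>R (m + n) = r *\<^sub>R m + r *\<^sub>R n" "(r + s) *\<^sub>R m = r *\<^sub>R m + s *\<^sub>R m"
    "r *\<^sub>R s *\<^sub>R m = (r * s) *\<^sub>R m" "1 *\<^sub>R m = m"
    by (transfer; simp add: scaleR_add_right scaleR_add_left)+
  show "(norm m = 0) = (m = 0)" "norm (m + n) \<le> norm m + norm n" "norm (r *\<^sub>R m) = \<bar>r\<bar> * norm m"
    by (transfer; simp add: norm_triangle_ineq)+
qed

end

instance bidual :: (complex_banach_algebra) banach
proof
  fix X :: "nat \<Rightarrow> 'a bidual"
  have dst: "dist m n = dist (of_bidual m) (of_bidual n)" for m n :: "'a bidual"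
    by (simp add: dist_bidual_def dist_norm norm_bidual.rep_eq minus_bidual.rep_eq)
  assume "Cauchy X"
  then have "Cauchy (\<lambda>n. of_bidual (X n))"
    by (simp add: Cauchy_altdef dst)
  then obtain L where "(\<lambda>n. of_bidual (X n)) \<longlonglongrightarrow> L"
    using Cauchy_convergent_iff convergent_def by blast
  then have "\<forall>e>0. \<exists>N. \<forall>n\<ge>N. dist (X n) (Bidual L) < e"
    by (simp add: lim_sequentially dst Bidual_inverse)
  then have "X \<longlonglongrightarrow> Bidual L"
    by (simp only: lim_sequentially)
  then show "convergent X" by (rule convergentI)
qed

instantiation bidual :: (complex_banach_algebra) complex_banach_algebra
begin

lift_definition scaleC_bidual :: "complex \<Rightarrow> 'a bidual \<Rightarrow> 'a bidual" is scaleC .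
lift_definition times_bidual :: "'a bidual \<Rightarrow> 'a bidual \<Rightarrow> 'a bidual" is arens_prod .

instance
proof
  fix m n p :: "'a bidual" and r :: real and c d :: complex
  show "c *\<^sub>C (m + n) = c *\<^sub>C m + c *\<^sub>C n" "(c + d) *\<^sub>C m = c *\<^sub>C m + d *\<^sub>C m"
    "c *\<^sub>C d *\<^sub>C m = (c * d) *\<^sub>C m" "complex_of_real r *\<^sub>C m = r *\<^sub>R m"
    "norm (c *\<^sub>C m) = cmod c * norm m"
    by (transfer; simp add: scaleC_add_right scaleC_add_left scaleC_scaleC scaleC_of_real norm_scaleC)+
  have ract: "arens_act (x + y) f = arens_act x f + arens_act y f"
    "arens_act (c *\<^sub>C x) f = c *\<^sub>C arens_act x f" for x y :: "'a dual dual" and c f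
    by (rule dual_eqI; simp add: dual_apply_arens_act plus_dual.rep_eq scaleC_dual.rep_eq)+
  have C: "arens_prod (c *\<^sub>C x) y = c *\<^sub>C arens_prod x y"
    "arens_prod x (c *\<^sub>C y) = c *\<^sub>C arens_prod x y" for x y :: "'a dual dual" and c
    by (rule dual_eqI; simp add: dual_apply_arens_prod scaleC_dual.rep_eq ract
        dual_apply_scaleC_right)+
  show "m * n * p = m * (n * p)"
    by transfer (rule arens_prod_assoc)
  show "(m + n) * p = m * p + n * p" "m * (n + p) = m * n + m * p"
    by (transfer, rule dual_eqI, simp add: dual_apply_arens_prod plus_dual.rep_eq ract
        dual_apply_add_right)+
  show "(c *\<^sub>C m) * n = c *\<^sub>C (m * n)" "m * (c *\<^sub>C n) = c *\<^sub>C (m * n)"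
    by (transfer; simp add: C)+
  show "(r *\<^sub>R m) * n = r *\<^sub>R (m * n)" "m * (r *\<^sub>R n) = r *\<^sub>R (m * n)"
    by (transfer; simp add: C flip: scaleC_of_real)+
  show "norm (m * n) \<le> norm m * norm n"
    by transfer (rule norm_arens_prod_le)
qed

end

section \<open>Nets and ultra central approximate identities\<close>

definition directed_set :: "'i set \<Rightarrow> ('i \<Rightarrow> 'i \<Rightarrow> bool) \<Rightarrow> bool" where
  "directed_set I le \<longleftrightarrow> I \<noteq> {} \<and> reflp_on I le \<and> transp_on I le \<and>
     (\<forall>i\<in>I. \<forall>j\<in>I. \<exists>k\<in>I. le i k \<and> le j k)"

definition net_filter :: "'i set \<Rightarrow> ('i \<Rightarrow> 'i \<Rightarrow> bool) \<Rightarrow> 'i filter" where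
  "net_filter I le = (INF i\<in>I. principal {j \<in> I. le i j})"

lemma eventually_net_filter:
  assumes "directed_set I le"
  shows "eventually P (net_filter I le) \<longleftrightarrow> (\<exists>i\<in>I. \<forall>j\<in>I. le i j \<longrightarrow> P j)"
proof -
  have "eventually P (net_filter I le) \<longleftrightarrow> (\<exists>i\<in>I. eventually P (principal {j \<in> I. le i j}))"
    unfolding net_filter_def
  proof (rule eventually_INF_base)
    show "I \<noteq> {}" using assms by (simp add: directed_set_def)
    fix a b assume ab: "a \<in> I" "b \<in> I"
    then obtain k where k: "k \<in> I" "le a k" "le b k"
      using assms by (auto simp: directed_set_def)
    have "{j \<in> I. le k j} \<subseteq> {j \<in> I. le a j} \<inter> {j \<in> I. le b j}"
      using assms ab k by (auto simp: directed_set_def dest: transp_onD)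
    then show "\<exists>x\<in>I. principal {j \<in> I. le x j} \<le> inf (principal {j \<in> I. le a j}) (principal {j \<in> I. le b j})"
      using k by auto
  qed
  then show ?thesis by (auto simp: eventually_principal)
qed

text \<open>The net takes values in the second dual of \<open>B\<close>, so \<open>e\<^sub>i \<cdot> b \<rightarrow> b\<close> refers to the
  canonical image of \<open>b\<close> there.\<close>

definition ultra_central_approximate_identity ::
    "'i set \<Rightarrow> ('i \<Rightarrow> 'i \<Rightarrow> bool) \<Rightarrow> ('i \<Rightarrow> 'b::complex_banach_algebra dual dual) \<Rightarrow> bool" where
  "ultra_central_approximate_identity I le e \<longleftrightarrow>
     directed_set I le \<and>
     (\<forall>i\<in>I. \<forall>b. bidual_lact b (e i) = bidual_ract (e i) b) \<and>
     (\<forall>b. ((\<lambda>i. bidual_ract (e i) b) \<longlongrightarrow> canonical b) (net_filter I le))"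

section \<open>Characters and inner amenability\<close>

text \<open>Characters are not required to be bounded; \<open>character_norm_le\<close> shows that they are.\<close>

definition characters :: "('a::complex_banach_algebra \<Rightarrow> complex) set" where
  "characters = {\<phi>. (\<forall>x y. \<phi> (x + y) = \<phi> x + \<phi> y) \<and> (\<forall>c x. \<phi> (c *\<^sub>C x) = c * \<phi> x) \<and>
     (\<forall>x y. \<phi> (x * y) = \<phi> x * \<phi> y) \<and> (\<exists>x. \<phi> x \<noteq> 0)}"

lemma character_norm_le:
  fixes \<phi> :: "'a::complex_banach_algebra \<Rightarrow> complex"
  assumes "\<phi> \<in> characters"
  shows "cmod (\<phi> x) \<le> norm x"
proof (rule ccontr)
  assume "\<not> cmod (\<phi> x) \<le> norm x"
  then have less: "norm x < cmod (\<phi> x)" by simp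
  then have nz: "\<phi> x \<noteq> 0" using norm_ge_zero[of x] by fastforce
  define a where "a = inverse (\<phi> x) *\<^sub>C x"
  have \<phi>a: "\<phi> a = 1" using assms nz by (simp add: a_def characters_def)
  have na: "norm a < 1"
  proof -
    have "norm a = norm x / cmod (\<phi> x)"
      by (simp add: a_def norm_scaleC norm_inverse divide_inverse mult.commute)
    then show ?thesis using less nz by simp
  qed
  define p where "p n = (((*) a) ^^ n) a" for n :: nat
  have pSuc: "p (Suc n) = a * p n" for n by (simp add: p_def)
  have pn: "norm (p n) \<le> norm a ^ Suc n" for n
  proof (induction n)
    case (Suc n)
    have "norm (p (Suc n)) \<le> norm a * norm (p n)"
      by (simp add: p_def norm_mult_ineq)
    also have "\<dots> \<le> norm a * norm a ^ Suc n" by (rule mult_left_mono[OF Suc.IH]) simp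
    finally show ?case by simp
  qed (simp add: p_def)
  have "summable (\<lambda>n. norm a ^ Suc n)"
    using na by (simp only: summable_Suc_iff) (simp add: summable_geometric)
  then have sp: "summable p"
    by (rule summable_comparison_test'[where N = 0]) (rule pn)
  define b where "b = suminf p"
  have "b = p 0 + (\<Sum>n. p (Suc n))"
    using suminf_split_head[OF sp] by (simp add: b_def)
  also have "(\<Sum>n. p (Suc n)) = a * b"
    using bounded_linear.suminf[OF bounded_linear_mult_right[of a] sp] by (simp add: pSuc b_def)
  finally have "b = a + a * b" by (simp add: p_def)
  then have "\<phi> b = \<phi> (a + a * b)" by (rule arg_cong)
  also have "\<dots> = \<phi> a + \<phi> a * \<phi> b" using assms by (simp add: characters_def)
  finally have "\<phi> b = \<phi> a + \<phi> a * \<phi> b" .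
  then show False using \<phi>a by simp
qed

lemma dual_apply_Dual_character: "\<phi> \<in> characters \<Longrightarrow> dual_apply (Dual \<phi>) = \<phi>"
  by (rule dual_apply_Dual, rule bounded_clinear_functionalI[where K = 1])
    (use character_norm_le[of \<phi>] in \<open>auto simp: characters_def\<close>)

definition inner_amenable :: "('a::complex_banach_algebra \<Rightarrow> complex) \<Rightarrow> bool" where
  "inner_amenable \<phi> \<longleftrightarrow>
     (\<exists>m :: 'a dual dual. dual_apply m (Dual \<phi>) = 1 \<and>
       (\<forall>f. \<forall>a\<in>{a. \<phi> a = 1}. dual_apply m (dual_ract f a) = dual_apply m (dual_lact a f)))"

end

theory Submission
  imports Defs
begin

text \<open>
  The idea is to restrict the functionals \<open>e\<^sub>i\<close> on \<open>A***\<close> to \<open>A*\<close>. Every \<open>f\<close> in \<open>A*\<close> acts on \<open>A**\<close>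
  by evaluation, and this embedding \<open>A* \<rightarrow> A***\<close> intertwines the action of \<open>a\<close> in \<open>A\<close> with that of
  its canonical image in \<open>A**\<close> on both sides (lemmas \<open>dual_ract_evaluation\<close> and
  \<open>dual_lact_evaluation\<close>): the first Arens product with an element of \<open>A\<close>, on either side, is the
  bimodule action of that element. The centrality of \<open>e\<^sub>i\<close> therefore implies that its
  restriction \<open>m\<^sub>i\<close> satisfies \<open>m\<^sub>i(f \<cdot> a) = m\<^sub>i(a \<cdot> f)\<close> for all \<open>f\<close> and \<open>a\<close>.

  It remains to find \<open>i\<close> with \<open>m\<^sub>i(\<phi>) \<noteq> 0\<close>, since then a scalar multiple of \<open>m\<^sub>i\<close> takes the value \<open>1\<close>
  at \<open>\<phi>\<close>. Choose \<open>a\<close> with \<open>\<phi>(a) = 1\<close>. Multiplicativity gives \<open>a \<cdot> \<phi> = \<phi>\<close>, so evaluating the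
  convergence \<open>e\<^sub>i \<cdot> a \<rightarrow> a\<close> at \<open>\<phi>\<close> yields \<open>m\<^sub>i(\<phi>) = m\<^sub>i(a \<cdot> \<phi>) \<rightarrow> \<phi>(a) = 1\<close>. A single
  late index suffices, so no limit of the \<open>m\<^sub>i\<close> has to be formed.
\<close>

definition evaluation :: "'a::complex_banach_algebra dual \<Rightarrow> 'a bidual dual" where
  "evaluation f = Dual (\<lambda>x. dual_apply (of_bidual x) f)"

lemma dual_apply_evaluation: "dual_apply (evaluation f) x = dual_apply (of_bidual x) f"
proof -
  have "cmod (dual_apply (of_bidual y) f) \<le> norm f * norm y" for y :: "'a bidual"
    using norm_dual_le[of "of_bidual y" f] by (simp add: norm_bidual.rep_eq mult.commute)
  then show ?thesis
    unfolding evaluation_def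
    by (subst dual_apply_Dual)
      (auto intro!: bounded_clinear_functionalI[where K = "norm f"]
        simp: plus_bidual.rep_eq scaleC_bidual.rep_eq plus_dual.rep_eq scaleC_dual.rep_eq)
qed

lemma norm_evaluation_le: "norm (evaluation f) \<le> norm f"
  by (rule norm_dual_bound)
    (use norm_dual_le[of _ f] in
      \<open>auto simp: dual_apply_evaluation norm_bidual.rep_eq mult.commute[of "norm f"]\<close>)

definition restrict_functional ::
    "'a::complex_banach_algebra bidual dual dual \<Rightarrow> 'a dual dual" where
  "restrict_functional n = Dual (\<lambda>f. dual_apply n (evaluation f))"

lemma dual_apply_restrict_functional:
  "dual_apply (restrict_functional n) f = dual_apply n (evaluation f)"
proof -
  have "evaluation (f + g) = evaluation f + evaluation g"
    "evaluation (c *\<^sub>C f) = c *\<^sub>C evaluation f" for f g :: "'a dual" and c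
    by (rule dual_eqI; simp add: dual_apply_evaluation plus_dual.rep_eq scaleC_dual.rep_eq
        dual_apply_add_right dual_apply_scaleC_right)+
  then show ?thesis
    unfolding restrict_functional_def
    by (subst dual_apply_Dual)
      (auto intro!: bounded_clinear_functionalI[where K = "norm n"] dual_apply_le
        norm_evaluation_le simp: dual_apply_add_right dual_apply_scaleC_right)
qed

text \<open>By definition of the first Arens product, left multiplication of \<open>x\<close> in \<open>A**\<close> by the image
  of \<open>a\<close> is \<open>f \<mapsto> x(f \<cdot> a)\<close>.\<close>

lemma dual_ract_evaluation:
  "dual_ract (evaluation f) (Bidual (canonical a)) = evaluation (dual_ract f a)"
  by (rule dual_eqI)
    (simp add: dual_apply_ract dual_apply_evaluation times_bidual.rep_eq Bidual_inverse
      dual_apply_arens_prod dual_apply_canonical dual_apply_arens_act)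

lemma arens_act_canonical: "arens_act (canonical a) f = dual_lact a f"
  by (rule dual_eqI)
    (simp add: dual_apply_arens_act dual_apply_canonical dual_apply_ract dual_apply_lact)

lemma dual_lact_evaluation:
  "dual_lact (Bidual (canonical a)) (evaluation f) = evaluation (dual_lact a f)"
  by (rule dual_eqI)
    (simp add: dual_apply_lact dual_apply_evaluation times_bidual.rep_eq Bidual_inverse
      dual_apply_arens_prod arens_act_canonical)

lemma dual_lact_character:
  assumes "\<phi> \<in> characters"
  shows "dual_lact a (Dual \<phi>) = \<phi> a *\<^sub>C Dual \<phi>"
  using assms
  by (intro dual_eqI)
    (simp add: dual_apply_lact scaleC_dual.rep_eq dual_apply_Dual_character characters_def)

lemma character_takes_one:
  assumes "\<phi> \<in> characters"
  obtains a where "\<phi> a = 1"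
proof -
  obtain x where "\<phi> x \<noteq> 0" using assms by (auto simp: characters_def)
  then have "\<phi> (inverse (\<phi> x) *\<^sub>C x) = 1" using assms by (simp add: characters_def)
  then show thesis by (rule that)
qed

lemma restrict_functional_central:
  assumes "bidual_lact (Bidual (canonical a)) n = bidual_ract n (Bidual (canonical a))"
  shows "dual_apply (restrict_functional n) (dual_ract f a) =
    dual_apply (restrict_functional n) (dual_lact a f)"
  using arg_cong[OF assms, of "\<lambda>k. dual_apply k (evaluation f)"]
  by (simp add: dual_apply_bidual_lact dual_apply_bidual_ract dual_ract_evaluation
      dual_lact_evaluation dual_apply_restrict_functional)

lemma tendsto_dual_apply:
  assumes "(f \<longlongrightarrow> g) F"
  shows "((\<lambda>i. dual_apply (f i) x) \<longlongrightarrow> dual_apply g x) F"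
proof -
  have "bounded_linear (\<lambda>h. dual_apply h x)"
    by (rule bounded_linear_intro[where K = "norm x"])
      (auto simp: plus_dual.rep_eq scaleR_dual.rep_eq norm_dual_le)
  then show ?thesis using assms by (rule bounded_linear.tendsto)
qed

lemma eventually_net_filter_imp_ex:
  assumes "directed_set I le" and "eventually P (net_filter I le)"
  obtains i where "i \<in> I" "P i"
  using assms by (auto simp: eventually_net_filter directed_set_def dest: reflp_onD)

text \<open>Centrality is a linear condition, so only non-vanishing at the character has to be arranged.\<close>

lemma inner_amenableI_nonzero:
  fixes m :: "'a::complex_banach_algebra dual dual"
  assumes nz: "dual_apply m (Dual \<phi>) \<noteq> 0"
    and central: "\<And>f a. \<phi> a = 1 \<Longrightarrow> dual_apply m (dual_ract f a) = dual_apply m (dual_lact a f)"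
  shows "inner_amenable \<phi>"
  unfolding inner_amenable_def
  by (rule exI[of _ "inverse (dual_apply m (Dual \<phi>)) *\<^sub>C m"])
    (use nz central in \<open>auto simp: scaleC_dual.rep_eq\<close>)

theorem theorem5p1:
  fixes \<phi> :: "'a::complex_banach_algebra \<Rightarrow> complex"
    and I :: "'i set"
    and le :: "'i \<Rightarrow> 'i \<Rightarrow> bool"
    and e :: "'i \<Rightarrow> 'a bidual dual dual"
  assumes "\<phi> \<in> characters"
    and "ultra_central_approximate_identity I le e"
  shows "inner_amenable \<phi>"
proof -
  have directed: "directed_set I le"
    and central: "\<And>i b. i \<in> I \<Longrightarrow> bidual_lact b (e i) = bidual_ract (e i) b"
    and approx: "\<And>b. ((\<lambda>i. bidual_ract (e i) b) \<longlongrightarrow> canonical b) (net_filter I le)"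
    using assms(2) by (auto simp: ultra_central_approximate_identity_def)
  obtain a where a: "\<phi> a = 1" using assms(1) by (rule character_takes_one)
  have fixed: "dual_lact a (Dual \<phi>) = Dual \<phi>"
    unfolding dual_lact_character[OF assms(1)] a
    by (rule dual_eqI) (simp add: scaleC_dual.rep_eq)
  have "((\<lambda>i. dual_apply (bidual_ract (e i) (Bidual (canonical a))) (evaluation (Dual \<phi>)))
      \<longlongrightarrow> dual_apply (canonical (Bidual (canonical a))) (evaluation (Dual \<phi>))) (net_filter I le)"
    by (intro tendsto_dual_apply approx)
  then have "((\<lambda>i. dual_apply (restrict_functional (e i)) (Dual \<phi>)) \<longlongrightarrow> 1) (net_filter I le)"
    by (simp add: dual_apply_bidual_ract dual_lact_evaluation fixed dual_apply_canonical
        dual_apply_evaluation Bidual_inverse dual_apply_Dual_character[OF assms(1)] a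
        dual_apply_restrict_functional)
  then have "eventually (\<lambda>i. dual_apply (restrict_functional (e i)) (Dual \<phi>) \<noteq> 0)
      (net_filter I le)"
    by (rule tendsto_imp_eventually_ne) simp
  then obtain i where i: "i \<in> I" "dual_apply (restrict_functional (e i)) (Dual \<phi>) \<noteq> 0"
    by (rule eventually_net_filter_imp_ex[OF directed])
  show ?thesis
    using i(2) restrict_functional_central[OF central[OF i(1)]]
    by (rule inner_amenableI_nonzero)
qed

end
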